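(* Let $c\in\mathbb{C}\setminus\{0\}$ and $q\in\mathbb{C}\setminus\{0,1\}$. Let $f$ be a non-constant meromorphic function on $\mathbb{C}$, and let $\tau(z)$ denote one of the three maps $\tau(z)=z+c$, $\tau(z)=qz$, $\tau(z)=qz+c$. Suppose that $f$ satisfies the corresponding Fermat-type functional equation $$f^2(z)+f^2(\tau(z))=1,$$ that is, respectively, $f^2(z)+f^2(z+c)=1$, $f^2(z)+f^2(qz)=1$, or $f^2(z)+f^2(qz+c)=1$. Then $$f(z)=\frac{2\omega(z)}{1+\omega^2(z)},$$ where $\omega(z)$ is a non-constant meromorphic function on $\mathbb{C}$ satisfying one of the Riccati type equations: either $$\omega(\tau(z))=\frac{1+\omega(z)}{1-\omega(z)}\qquad\text{or}\qquad \omega(\tau(z))=\frac{1-\omega(z)}{1+\omega(z)}$$ (with the same $\tau$).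
   Context: Meromorphic means meromorphic on the whole complex plane $\mathbb{C}$. Notation: $f^2(z)=(f(z))^2$. A Riccati type equation is an equation of the form $f(qz+c)=\frac{a_1(z)+b_1(z)f(z)}{c_1(z)+d_1(z)f(z)}$ with $q\neq 0$ and small coefficient functions satisfying $a_1d_1-b_1c_1\not\equiv 0$. All identities are identities of meromorphic functions. *)

theory Defs
  imports "HOL-Complex_Analysis.Complex_Analysis"
begin

(* A meromorphic function on the plane is represented by a total function
   complex => complex whose values at the poles (and on any other closed discrete set)
   carry no information.  Hence identities of meromorphic functions are equalities off a
   closed discrete subset of the plane, i.e. equalities holding eventually in the filter
   cosparse UNIV. *)

definition mero_eq :: "(complex \<Rightarrow> complex) \<Rightarrow> (complex \<Rightarrow> complex) \<Rightarrow> bool"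
    (infix "\<approx>\<^sub>M" 50) where
  "f \<approx>\<^sub>M g \<longleftrightarrow> (\<forall>\<^sub>F z in cosparse UNIV. f z = g z)"

definition nonconstant_meromorphic :: "(complex \<Rightarrow> complex) \<Rightarrow> bool" where
  "nonconstant_meromorphic f \<longleftrightarrow>
     f meromorphic_on UNIV \<and> \<not> (\<exists>a. f \<approx>\<^sub>M (\<lambda>z. a))"

end

theory Submission
  imports Defs
begin

text \<open>
  Write \<open>g = f \<circ> \<tau>\<close>, so that \<open>f\<^sup>2 + g\<^sup>2 = 1\<close>. The unit circle has the rational parametrization
  \<open>(f, g) = (2\<omega> / (1 + \<omega>\<^sup>2), (1 - \<omega>\<^sup>2) / (1 + \<omega>\<^sup>2))\<close>, whose inverse is \<open>\<omega> = f / (1 + g)\<close>; this is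
  the function \<open>\<omega>\<close> sought (with \<open>f = sin \<theta>\<close> and \<open>g = cos \<theta>\<close> it is \<open>tan (\<theta>/2)\<close>). Since
  \<open>\<tau>\<close> is an affine bijection and \<open>f\<close> is not constant, \<open>g\<close> is not identically \<open>-1\<close>, so \<open>\<omega>\<close> is a
  meromorphic function; it is non-constant because \<open>f\<close> is a function of \<open>\<omega>\<close>.

  Put \<open>v = \<omega> \<circ> \<tau>\<close>. Composing the formula for \<open>f\<close> with \<open>\<tau>\<close> gives a second expression for \<open>g\<close>, namely
  \<open>2v / (1 + v\<^sup>2)\<close>. Equating it with the first gives a quadratic equation for \<open>v\<close> that splits as
  \<open>(v (1 - \<omega>) - (1 + \<omega>)) (v (1 + \<omega>) - (1 - \<omega>)) = 0\<close>. Meromorphic functions on the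
  plane have no zero divisors (\<open>mero_mult_eq_0_imp\<close>), so one of the two factors vanishes
  identically, and each of them amounts to one of the two Riccati equations.
\<close>

text \<open>
  By the identity theorem, \<open>f\<close> either vanishes identically or vanishes only on a closed discrete
  set. Only one factor has to be meromorphic for this.
\<close>
lemma mero_mult_eq_0_imp:
  assumes "f meromorphic_on UNIV" and "(\<lambda>z. f z * g z) \<approx>\<^sub>M (\<lambda>z. 0)"
  shows "f \<approx>\<^sub>M (\<lambda>z. 0) \<or> g \<approx>\<^sub>M (\<lambda>z. 0)"
proof -
  have "(\<forall>\<^sub>F z in cosparse UNIV. f z = 0) \<or> (\<forall>\<^sub>F z in cosparse UNIV. f z \<noteq> 0)"
    using assms(1) by (intro meromorphic_imp_constant_or_avoid) auto
  moreover have "\<forall>\<^sub>F z in cosparse UNIV. g z = 0" if "\<forall>\<^sub>F z in cosparse UNIV. f z \<noteq> 0"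
    using that assms(2) unfolding mero_eq_def by eventually_elim auto
  ultimately show ?thesis by (auto simp: mero_eq_def)
qed

lemma nonconstant_meromorphic_avoids:
  assumes "nonconstant_meromorphic f"
  shows "\<forall>\<^sub>F z in cosparse UNIV. f z \<noteq> a"
  using assms meromorphic_imp_constant_or_avoid[of f UNIV a]
  by (auto simp: nonconstant_meromorphic_def mero_eq_def)

lemma eventually_cosparse_affine:
  fixes a b :: complex
  assumes "a \<noteq> 0" and "eventually P (cosparse UNIV)"
  shows "\<forall>\<^sub>F z in cosparse UNIV. P (a * z + b)"
proof -
  have "\<forall>\<^sub>F z in at x. P (a * z + b)" for x
  proof -
    have "filterlim (\<lambda>z. a * z + b) (at (a * x + b)) (at x)"
      unfolding filterlim_at using assms(1)
      by (auto intro!: tendsto_eq_intros simp: eventually_at_filter)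
    moreover have "\<forall>\<^sub>F y in at (a * x + b). P y"
      using assms(2) by (auto simp: eventually_cosparse_open_eq)
    ultimately show ?thesis by (rule eventually_compose_filterlim[rotated])
  qed
  thus ?thesis by (simp add: eventually_cosparse_open_eq)
qed

lemma circle_param:
  fixes x y :: "'a :: field_char_0"
  assumes "x\<^sup>2 + y\<^sup>2 = 1" and "y \<noteq> -1"
  defines "w \<equiv> x / (1 + y)"
  shows "1 + w\<^sup>2 \<noteq> 0" and "x = 2 * w / (1 + w\<^sup>2)" and "y = (1 - w\<^sup>2) / (1 + w\<^sup>2)"
proof -
  have y: "1 + y \<noteq> 0" using assms(2) by (metis add_eq_0_iff)
  have x2: "x\<^sup>2 = (1 + y) * (1 - y)" using assms(1) by (simp add: algebra_simps power2_eq_square)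
  have "w\<^sup>2 = (1 - y) / (1 + y)"
    using y x2 by (simp add: w_def power_divide power2_eq_square)
  hence p: "1 + w\<^sup>2 = 2 / (1 + y)" and m: "1 - w\<^sup>2 = 2 * y / (1 + y)"
    using y by (simp_all add: field_simps)
  show "1 + w\<^sup>2 \<noteq> 0" using p y by simp
  show "x = 2 * w / (1 + w\<^sup>2)" unfolding p using y by (simp add: w_def)
  show "y = (1 - w\<^sup>2) / (1 + w\<^sup>2)" unfolding p m using y by simp
qed

theorem theorem2p1:
  fixes c q :: complex and f \<tau> :: "complex \<Rightarrow> complex"
  assumes "c \<noteq> 0" and "q \<noteq> 0" and "q \<noteq> 1"
    and "nonconstant_meromorphic f"
    and "\<tau> = (\<lambda>z. z + c) \<or> \<tau> = (\<lambda>z. q * z) \<or> \<tau> = (\<lambda>z. q * z + c)"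
    and "(\<lambda>z. (f z)\<^sup>2 + (f (\<tau> z))\<^sup>2) \<approx>\<^sub>M (\<lambda>z. 1)"
  shows "\<exists>\<omega>. nonconstant_meromorphic \<omega> \<and>
           f \<approx>\<^sub>M (\<lambda>z. 2 * \<omega> z / (1 + (\<omega> z)\<^sup>2)) \<and>
           ((\<lambda>z. \<omega> (\<tau> z)) \<approx>\<^sub>M (\<lambda>z. (1 + \<omega> z) / (1 - \<omega> z)) \<or>
            (\<lambda>z. \<omega> (\<tau> z)) \<approx>\<^sub>M (\<lambda>z. (1 - \<omega> z) / (1 + \<omega> z)))"
proof -
  obtain a b where a: "a \<noteq> 0" and \<tau>: "\<tau> = (\<lambda>z. a * z + b)"
  proof -
    have "\<tau> = (\<lambda>z. 1 * z + c) \<or> \<tau> = (\<lambda>z. q * z + 0) \<or> \<tau> = (\<lambda>z. q * z + c)"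
      using assms(5) by simp
    thus ?thesis using that \<open>q \<noteq> 0\<close> zero_neq_one by metis
  qed
  have ev_\<tau>: "\<forall>\<^sub>F z in cosparse UNIV. P (\<tau> z)" if "eventually P (cosparse UNIV)" for P
    using eventually_cosparse_affine[OF a that] by (simp add: \<tau>)
  have mero_\<tau>: "(\<lambda>z. h (\<tau> z)) meromorphic_on UNIV" if "h meromorphic_on UNIV" for h
    using that unfolding \<tau> by (rule meromorphic_on_compose) (auto intro!: analytic_intros)
  have mero_f: "f meromorphic_on UNIV"
    using assms(4) by (simp add: nonconstant_meromorphic_def)
  have circle: "\<forall>\<^sub>F z in cosparse UNIV. (f z)\<^sup>2 + (f (\<tau> z))\<^sup>2 = 1"
    using assms(6) by (simp add: mero_eq_def)

  have avoid: "\<forall>\<^sub>F z in cosparse UNIV. f (\<tau> z) \<noteq> -1"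
    using nonconstant_meromorphic_avoids[OF assms(4)] by (rule ev_\<tau>)
  define \<omega> where "\<omega> = (\<lambda>z. f z / (1 + f (\<tau> z)))"
  have mero_\<omega>: "\<omega> meromorphic_on UNIV"
    unfolding \<omega>_def by (intro meromorphic_intros mero_f mero_\<tau>)
  have param: "\<forall>\<^sub>F z in cosparse UNIV. 1 + (\<omega> z)\<^sup>2 \<noteq> 0 \<and> f z = 2 * \<omega> z / (1 + (\<omega> z)\<^sup>2) \<and>
                 f (\<tau> z) = (1 - (\<omega> z)\<^sup>2) / (1 + (\<omega> z)\<^sup>2)"
    using circle avoid
  proof eventually_elim
    case (elim z)
    show ?case using circle_param[OF elim] unfolding \<omega>_def by blast
  qed
  have f_eq: "f \<approx>\<^sub>M (\<lambda>z. 2 * \<omega> z / (1 + (\<omega> z)\<^sup>2))"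
    unfolding mero_eq_def using param by eventually_elim blast
  have nonconst: "nonconstant_meromorphic \<omega>"
    unfolding nonconstant_meromorphic_def
  proof (intro conjI mero_\<omega> notI)
    assume "\<exists>k. \<omega> \<approx>\<^sub>M (\<lambda>z. k)"
    then obtain k where "\<forall>\<^sub>F z in cosparse UNIV. \<omega> z = k" by (auto simp: mero_eq_def)
    with f_eq[unfolded mero_eq_def] have "f \<approx>\<^sub>M (\<lambda>z. 2 * k / (1 + k\<^sup>2))"
      unfolding mero_eq_def by eventually_elim simp
    thus False using assms(4) by (auto simp: nonconstant_meromorphic_def)
  qed

  define F G where "F = (\<lambda>z. \<omega> (\<tau> z) * (1 - \<omega> z) - (1 + \<omega> z))"
    and "G = (\<lambda>z. \<omega> (\<tau> z) * (1 + \<omega> z) - (1 - \<omega> z))"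
  have "(\<lambda>z. F z * G z) \<approx>\<^sub>M (\<lambda>z. 0)"
    unfolding mero_eq_def using param ev_\<tau>[OF param]
  proof eventually_elim
    case (elim z)
    let ?w = "\<omega> z" and ?v = "\<omega> (\<tau> z)"
    have "(1 - ?w\<^sup>2) * (1 + ?v\<^sup>2) = 2 * ?v * (1 + ?w\<^sup>2)"
      using elim by (metis frac_eq_eq)
    moreover have "F z * G z = (1 - ?w\<^sup>2) * (1 + ?v\<^sup>2) - 2 * ?v * (1 + ?w\<^sup>2)"
      by (simp add: F_def G_def algebra_simps power2_eq_square)
    ultimately show ?case by simp
  qed
  moreover have "F meromorphic_on UNIV"
    unfolding F_def by (intro meromorphic_intros mero_\<omega> mero_\<tau>)
  ultimately have "F \<approx>\<^sub>M (\<lambda>z. 0) \<or> G \<approx>\<^sub>M (\<lambda>z. 0)"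
    by (intro mero_mult_eq_0_imp)
  moreover have "(\<lambda>z. \<omega> (\<tau> z)) \<approx>\<^sub>M (\<lambda>z. (1 + \<omega> z) / (1 - \<omega> z))" if "F \<approx>\<^sub>M (\<lambda>z. 0)"
    unfolding mero_eq_def
    using that[unfolded mero_eq_def] nonconstant_meromorphic_avoids[OF nonconst, of 1]
    by eventually_elim (simp add: F_def eq_divide_eq)
  moreover have "(\<lambda>z. \<omega> (\<tau> z)) \<approx>\<^sub>M (\<lambda>z. (1 - \<omega> z) / (1 + \<omega> z))" if "G \<approx>\<^sub>M (\<lambda>z. 0)"
    unfolding mero_eq_def
    using that[unfolded mero_eq_def] nonconstant_meromorphic_avoids[OF nonconst, of "-1"]
    by eventually_elim (simp add: G_def eq_divide_eq add_eq_0_iff)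
  ultimately show ?thesis using nonconst f_eq by blast
qed

end
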